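(* Let $\mathcal{O}$ be a valuation ring. Then the group $GL_2(\mathcal{O})$ is generated by the matrices $$R(a)=\begin{pmatrix}a&0\\0&1\end{pmatrix}\ (a\in\mathcal{O}^\times\setminus\{1\}),\qquad S=\begin{pmatrix}-1&1\\0&1\end{pmatrix},\qquad J=\begin{pmatrix}0&-1\\-1&0\end{pmatrix},$$ subject to the following defining relations, in which $Z(a):=(J\cdot R(a))^2$ for $a\in\mathcal{O}^\times\setminus\{1\}$ and $R(1)=Z(1):=1$: \begin{align*} &R(a)R(b)=R(ab),\quad Z(a)Z(b)=Z(ab),\quad [R(a),Z(b)]=1 && (a,b\in\mathcal{O}^\times\setminus\{1\}),\\ &[S,Z(a)]=1 && (a\in\mathcal{O}^\times\setminus\{1\}),\\ &S^2=1,\\ &[S,R(1-at_\alpha)]=R(a)\,[S,R(1-t_\alpha)]\,R(a)^{-1} && (\alpha\in\Lambda_+\setminus\{0\},\ a\in\mathcal{O}^\times\setminus\{1\}),\\ &S\,R(a)\,S=R(1-a)\,S\,R\Big(\frac{a}{a-1}\Big) && (a\in\mathfrak{k}),\\ &J^2=1,\quad (J\cdot S)^3=1. \end{align*}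
   Context: "Generated by ... subject to the relations" means that the abstract group with the listed generators and relations is isomorphic to the given group via the indicated assignment of generators to matrices. Commutators are $[x,y]=xyx^{-1}y^{-1}$. $\mathcal{O}$ is the valuation ring of a valued field $(K,v)$ ($K$ the fraction field of $\mathcal{O}$; the trivial valuation is allowed), with maximal ideal $\mathfrak{m}$, residue field $k=\mathcal{O}/\mathfrak{m}$, unit group $\mathcal{O}^\times$, totally ordered abelian value group $\Lambda=v(K^\times)\cong K^\times/\mathcal{O}^\times$ written additively, and $\Lambda_+=\{\alpha\in\Lambda:\alpha\geq 0\}=v(\mathcal{O}\setminus\{0\})$. For each $\alpha\in\Lambda_+$ an element $t_\alpha\in\mathcal{O}$ with $v(t_\alpha)=\alpha$ is fixed, with $t_0=1$. $\mathfrak{k}\subseteq\mathcal{O}^\times\setminus(1+\mathfrak{m})$ is a fixed set of representatives modulo $\mathfrak{m}$ of the elements of $k^\times\setminus\{1\}$. *)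

theory Defs
  imports "HOL-Analysis.Analysis" "HOL-Algebra.Group"
begin

section \<open>Valuation rings\<close>

text \<open>
  The symbol \<open>\<infinity>\<close> is avoided: a valuation is a function on the whole field of which only the
  values at nonzero elements matter, and \<open>v 0\<close> is unspecified. The value group is the image of
  the nonzero elements, so the trivial valuation is allowed for every target group \<open>'l\<close>.
\<close>

definition valuation :: "('k::field \<Rightarrow> 'l::linordered_ab_group_add) \<Rightarrow> bool" where
  "valuation v \<longleftrightarrow>
     (\<forall>x y. x \<noteq> 0 \<longrightarrow> y \<noteq> 0 \<longrightarrow> v (x * y) = v x + v y) \<and>
     (\<forall>x y. x \<noteq> 0 \<longrightarrow> y \<noteq> 0 \<longrightarrow> x + y \<noteq> 0 \<longrightarrow> min (v x) (v y) \<le> v (x + y))"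

definition value_group :: "('k::field \<Rightarrow> 'l::linordered_ab_group_add) \<Rightarrow> 'l set" where
  "value_group v = v ` (UNIV - {0})"

definition value_monoid :: "('k::field \<Rightarrow> 'l::linordered_ab_group_add) \<Rightarrow> 'l set" where
  "value_monoid v = {\<alpha> \<in> value_group v. 0 \<le> \<alpha>}"

definition val_ring :: "('k::field \<Rightarrow> 'l::linordered_ab_group_add) \<Rightarrow> 'k set" where
  "val_ring v = {x. x = 0 \<or> 0 \<le> v x}"

definition val_ideal :: "('k::field \<Rightarrow> 'l::linordered_ab_group_add) \<Rightarrow> 'k set" where
  "val_ideal v = {x. x = 0 \<or> 0 < v x}"

definition val_units :: "('k::field \<Rightarrow> 'l::linordered_ab_group_add) \<Rightarrow> 'k set" where
  "val_units v = {x \<in> val_ring v. \<exists>y \<in> val_ring v. x * y = 1}"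

definition residue_class :: "('k::field \<Rightarrow> 'l::linordered_ab_group_add) \<Rightarrow> 'k \<Rightarrow> 'k set" where
  "residue_class v x = {x + m | m. m \<in> val_ideal v}"

definition residue_field :: "('k::field \<Rightarrow> 'l::linordered_ab_group_add) \<Rightarrow> 'k set set" where
  "residue_field v = residue_class v ` val_ring v"


section \<open>The group \<open>GL\<^sub>2\<close> over a subring of a field\<close>

definition mat2_over :: "'k set \<Rightarrow> ('k^2^2) set" where
  "mat2_over A = {M. \<forall>i j. M $ i $ j \<in> A}"

definition GL2 :: "'k::field set \<Rightarrow> ('k^2^2) monoid" where
  "GL2 A = \<lparr>carrier = {M \<in> mat2_over A. \<exists>N \<in> mat2_over A. M ** N = mat 1 \<and> N ** M = mat 1},
            monoid.mult = (**), one = mat 1\<rparr>"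


section \<open>Groups given by generators and relations\<close>

text \<open>A letter \<open>(x, True)\<close> stands for the generator \<open>x\<close>, and \<open>(x, False)\<close> for its inverse.\<close>

type_synonym 'g word = "('g \<times> bool) list"

definition words :: "'g set \<Rightarrow> 'g word set" where
  "words X = lists (X \<times> UNIV)"

definition inv_word :: "'g word \<Rightarrow> 'g word" where
  "inv_word w = rev (map (\<lambda>(x, b). (x, \<not> b)) w)"

definition commutator_word :: "'g word \<Rightarrow> 'g word \<Rightarrow> 'g word" where
  "commutator_word u w = u @ w @ inv_word u @ inv_word w"

text \<open>
  The smallest congruence on the monoid of words in \<open>X\<close> that identifies \<open>x x\<^sup>-\<^sup>1\<close> and \<open>x\<^sup>-\<^sup>1 x\<close> with
  the empty word and \<open>l\<close> with \<open>r\<close> for every relation \<open>(l, r) \<in> E\<close>. Its quotient is the free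
  group on \<open>X\<close> modulo the normal closure of the elements \<open>l r\<^sup>-\<^sup>1\<close>.
  Pairs in \<open>E\<close> that are not words in \<open>X\<close> would be ignored; the relations used below only
  involve generators in \<open>X\<close>, because their arguments \<open>a b\<close>, \<open>1 - a t\<^sub>\<alpha>\<close>, \<open>1 - a\<close>, \<open>a / (a - 1)\<close>
  are units and \<open>R(1)\<close>, \<open>Z(1)\<close> are the empty word.
\<close>

inductive_set word_cong :: "'g set \<Rightarrow> ('g word \<times> 'g word) set \<Rightarrow> ('g word \<times> 'g word) set"
  for X :: "'g set" and E :: "('g word \<times> 'g word) set" where
  refl: "w \<in> words X \<Longrightarrow> (w, w) \<in> word_cong X E"
| sym: "(u, w) \<in> word_cong X E \<Longrightarrow> (w, u) \<in> word_cong X E"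
| trans: "(u, w) \<in> word_cong X E \<Longrightarrow> (w, z) \<in> word_cong X E \<Longrightarrow> (u, z) \<in> word_cong X E"
| cancel: "x \<in> X \<Longrightarrow> p \<in> words X \<Longrightarrow> q \<in> words X \<Longrightarrow>
    (p @ [(x, b), (x, \<not> b)] @ q, p @ q) \<in> word_cong X E"
| rel: "(l, r) \<in> E \<Longrightarrow> l \<in> words X \<Longrightarrow> r \<in> words X \<Longrightarrow> p \<in> words X \<Longrightarrow> q \<in> words X \<Longrightarrow>
    (p @ l @ q, p @ r @ q) \<in> word_cong X E"

definition word_class :: "'g set \<Rightarrow> ('g word \<times> 'g word) set \<Rightarrow> 'g word \<Rightarrow> 'g word set" where
  "word_class X E w = word_cong X E `` {w}"

definition presented_group :: "'g set \<Rightarrow> ('g word \<times> 'g word) set \<Rightarrow> 'g word set monoid" where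
  "presented_group X E =
     \<lparr>carrier = words X // word_cong X E,
      monoid.mult = (\<lambda>A B. word_cong X E `` {u @ w | u w. u \<in> A \<and> w \<in> B}),
      one = word_class X E []\<rparr>"

lemma word_cong_words: "(u, w) \<in> word_cong X E \<Longrightarrow> u \<in> words X \<and> w \<in> words X"
  by (induction rule: word_cong.induct) (auto simp: words_def)

lemma equiv_word_cong: "equiv (words X) (word_cong X E)"
proof (rule equivI)
  show "word_cong X E \<subseteq> words X \<times> words X"
    using word_cong_words by fastforce
  show "refl_on (words X) (word_cong X E)"
    by (auto intro!: refl_onI word_cong.refl dest: word_cong_words)
  show "sym (word_cong X E)"
    by (auto intro: symI word_cong.sym)
  show "trans (word_cong X E)"
    by (auto intro: transI word_cong.trans)
qed

lemma words_append [simp]: "u @ w \<in> words X \<longleftrightarrow> u \<in> words X \<and> w \<in> words X"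
  by (auto simp: words_def)

lemma words_Nil [simp]: "[] \<in> words X"
  by (simp add: words_def)

lemma word_cong_context:
  assumes "(u, w) \<in> word_cong X E" "p \<in> words X" "q \<in> words X"
  shows "(p @ u @ q, p @ w @ q) \<in> word_cong X E"
  using assms
proof (induction rule: word_cong.induct)
  case (cancel x p' q' b)
  then show ?case using word_cong.cancel[of x X "p @ p'" "q' @ q" b E] by simp
next
  case (rel l r p' q')
  then show ?case using word_cong.rel[of l r E X "p @ p'" "q' @ q"] by simp
qed (auto intro: word_cong.refl word_cong.sym word_cong.trans)

lemma word_cong_append:
  assumes "(u, u') \<in> word_cong X E" "(w, w') \<in> word_cong X E"
  shows "(u @ w, u' @ w') \<in> word_cong X E"
proof -
  have "(u @ w, u' @ w) \<in> word_cong X E"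
    using word_cong_context[OF assms(1), of "[]" w] word_cong_words[OF assms(2)] by simp
  moreover have "(u' @ w, u' @ w') \<in> word_cong X E"
    using word_cong_context[OF assms(2), of u' "[]"] word_cong_words[OF assms(1)] by simp
  ultimately show ?thesis by (rule word_cong.trans)
qed

lemma presented_group_mult:
  assumes "u \<in> words X" "w \<in> words X"
  shows "word_class X E u \<otimes>\<^bsub>presented_group X E\<^esub> word_class X E w = word_class X E (u @ w)"
  using assms
  by (auto simp: presented_group_def word_class_def
      intro: word_cong.trans word_cong_append word_cong.refl)

lemma inv_word_words: "w \<in> words X \<Longrightarrow> inv_word w \<in> words X"
  by (auto simp: words_def inv_word_def in_lists_conv_set)

lemma inv_word_cong: "w \<in> words X \<Longrightarrow> (inv_word w @ w, []) \<in> word_cong X E"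
proof (induction w)
  case Nil
  then show ?case by (simp add: inv_word_def word_cong.refl)
next
  case (Cons a w)
  obtain x b where a: "a = (x, b)" by force
  have w: "x \<in> X" "w \<in> words X" using Cons.prems by (auto simp: words_def a)
  have "(inv_word w @ [(x, \<not> b), (x, \<not> \<not> b)] @ w, inv_word w @ w) \<in> word_cong X E"
    by (intro word_cong.cancel w inv_word_words)
  then show ?case
    using Cons.IH[OF w(2)] by (auto simp: inv_word_def a intro: word_cong.trans)
qed

lemma carrier_presented_group: "carrier (presented_group X E) = word_class X E ` words X"
  by (auto simp: presented_group_def word_class_def quotient_def)

lemma one_presented_group: "\<one>\<^bsub>presented_group X E\<^esub> = word_class X E []"
  by (simp add: presented_group_def)

lemma group_presented_group: "group (presented_group X E)"
proof (rule groupI)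
  fix a assume "a \<in> carrier (presented_group X E)"
  then obtain w where w: "w \<in> words X" "a = word_class X E w"
    by (auto simp: carrier_presented_group)
  have "word_class X E (inv_word w @ w) = word_class X E []"
    unfolding word_class_def by (rule equiv_class_eq[OF equiv_word_cong inv_word_cong[OF w(1)]])
  then show "\<exists>b\<in>carrier (presented_group X E). b \<otimes>\<^bsub>presented_group X E\<^esub> a = \<one>\<^bsub>presented_group X E\<^esub>"
    using w by (auto simp: carrier_presented_group one_presented_group presented_group_mult
        inv_word_words intro!: bexI[of _ "inv_word w"])
qed (auto simp: carrier_presented_group one_presented_group presented_group_mult)


section \<open>The presentation\<close>

datatype 'k gl2_gen = Gen_R 'k | Gen_S | Gen_J

fun gl2_matrix :: "'k::field gl2_gen \<Rightarrow> 'k^2^2" where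
  "gl2_matrix (Gen_R a) = vector [vector [a, 0], vector [0, 1]]"
| "gl2_matrix Gen_S = vector [vector [-1, 1], vector [0, 1]]"
| "gl2_matrix Gen_J = vector [vector [0, -1], vector [-1, 0]]"

definition gl2_gens :: "('k::field \<Rightarrow> 'l::linordered_ab_group_add) \<Rightarrow> 'k gl2_gen set" where
  "gl2_gens v = Gen_R ` (val_units v - {1}) \<union> {Gen_S, Gen_J}"

definition word_R :: "'k::field \<Rightarrow> 'k gl2_gen word" where
  "word_R a = (if a = 1 then [] else [(Gen_R a, True)])"

definition word_S :: "'k gl2_gen word" where
  "word_S = [(Gen_S, True)]"

definition word_J :: "'k gl2_gen word" where
  "word_J = [(Gen_J, True)]"

definition word_Z :: "'k::field \<Rightarrow> 'k gl2_gen word" where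
  "word_Z a = (if a = 1 then [] else word_J @ word_R a @ word_J @ word_R a)"

inductive_set gl2_rels ::
  "('k::field \<Rightarrow> 'l::linordered_ab_group_add) \<Rightarrow> ('l \<Rightarrow> 'k) \<Rightarrow> 'k set \<Rightarrow>
     ('k gl2_gen word \<times> 'k gl2_gen word) set"
  for v :: "'k \<Rightarrow> 'l" and t :: "'l \<Rightarrow> 'k" and reps :: "'k set" where
  R_mult: "a \<in> val_units v - {1} \<Longrightarrow> b \<in> val_units v - {1} \<Longrightarrow>
    (word_R a @ word_R b, word_R (a * b)) \<in> gl2_rels v t reps"
| Z_mult: "a \<in> val_units v - {1} \<Longrightarrow> b \<in> val_units v - {1} \<Longrightarrow>
    (word_Z a @ word_Z b, word_Z (a * b)) \<in> gl2_rels v t reps"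
| R_Z: "a \<in> val_units v - {1} \<Longrightarrow> b \<in> val_units v - {1} \<Longrightarrow>
    (commutator_word (word_R a) (word_Z b), []) \<in> gl2_rels v t reps"
| S_Z: "a \<in> val_units v - {1} \<Longrightarrow>
    (commutator_word word_S (word_Z a), []) \<in> gl2_rels v t reps"
| S_square: "(word_S @ word_S, []) \<in> gl2_rels v t reps"
| S_R: "\<alpha> \<in> value_monoid v - {0} \<Longrightarrow> a \<in> val_units v - {1} \<Longrightarrow>
    (commutator_word word_S (word_R (1 - a * t \<alpha>)),
     word_R a @ commutator_word word_S (word_R (1 - t \<alpha>)) @ inv_word (word_R a))
      \<in> gl2_rels v t reps"
| S_R_S: "a \<in> reps \<Longrightarrow>
    (word_S @ word_R a @ word_S, word_R (1 - a) @ word_S @ word_R (a / (a - 1)))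
      \<in> gl2_rels v t reps"
| J_square: "(word_J @ word_J, []) \<in> gl2_rels v t reps"
| J_S: "((word_J @ word_S) @ (word_J @ word_S) @ (word_J @ word_S), []) \<in> gl2_rels v t reps"

end

theory Submission
  imports Defs
begin

text \<open>
  Put \<open>D(u) = [S, R(u)]\<close>; as a matrix this is the translation by \<open>1 - u\<close>. In the presented group
  define \<open>T(x) = R(x) S R(-1/x)\<close> for units \<open>x\<close> and \<open>T(x) = D(1 - x)\<close> for \<open>x\<close> in the maximal
  ideal. The cocycle identity \<open>D(u w) = D(u) R(u) D(w) R(u)\<^sup>-\<^sup>1\<close>, together with the relations for \<open>t\<^sub>\<alpha>\<close>
  and for the residue representatives, gives \<open>T(x) T(y) = T(x + y)\<close> on the whole valuation ring and
  \<open>R(a) T(x) R(a)\<^sup>-\<^sup>1 = T(a x)\<close>. As the \<open>Z(d)\<close> are central, \<open>B = {Z(d) T(b) R(a)}\<close> is a subgroup, and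
  the relation \<open>(J S)\<^sup>3 = 1\<close> shows that the union of \<open>B J T(\<O>)\<close> and \<open>B J T(\<MM>) J\<close> is stable under right
  multiplication by the generators, so it is everything. In these normal forms only the trivial element
  has the identity matrix, and every invertible matrix is the matrix of a normal form.
\<close>

section \<open>Valuation rings as local rings\<close>

locale valued_field =
  fixes v :: "'k::field \<Rightarrow> 'l::linordered_ab_group_add"
  assumes valuation: "valuation v"
begin

abbreviation "\<O> \<equiv> val_ring v"
abbreviation "\<U> \<equiv> val_units v"
abbreviation "\<MM> \<equiv> val_ideal v"

lemma v_mult: "x \<noteq> 0 \<Longrightarrow> y \<noteq> 0 \<Longrightarrow> v (x * y) = v x + v y"
  using valuation by (auto simp: valuation_def)

lemma v_add: "x \<noteq> 0 \<Longrightarrow> y \<noteq> 0 \<Longrightarrow> x + y \<noteq> 0 \<Longrightarrow> min (v x) (v y) \<le> v (x + y)"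
  using valuation by (auto simp: valuation_def)

lemma v_one [simp]: "v 1 = 0"
  using v_mult[of 1 1] by simp

lemma v_minus [simp]: "v (- x) = v x"
proof (cases "x = 0")
  case False
  \<comment> \<open>An ordered abelian group has no 2-torsion, so \<open>v (-1)\<close>
    vanishes.\<close>
  have "v (-1) + v (-1) = 0" using v_mult[of "-1" "-1"] by simp
  then have "v (-1) = 0" by (simp only: double_zero)
  with False show ?thesis using v_mult[of "-1" x] by simp
qed simp

lemma v_inverse: "x \<noteq> 0 \<Longrightarrow> v (inverse x) = - v x"
  using v_mult[of x "inverse x"] by (simp add: eq_neg_iff_add_eq_0 add.commute)

lemma units_iff: "x \<in> \<U> \<longleftrightarrow> x \<noteq> 0 \<and> v x = 0"
proof
  assume "x \<in> \<U>"
  then obtain y where y: "x \<in> \<O>" "y \<in> \<O>" "x * y = 1" by (auto simp: val_units_def)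
  then have nz: "x \<noteq> 0" "y \<noteq> 0" by auto
  have "v x + v y = 0" using v_mult[OF nz] y(3) by simp
  moreover have "0 \<le> v x" "0 \<le> v y" using y nz by (simp_all add: val_ring_def)
  ultimately have "v x = 0" using add_nonneg_eq_0_iff by blast
  with nz show "x \<noteq> 0 \<and> v x = 0" by simp
next
  assume "x \<noteq> 0 \<and> v x = 0"
  then have "x \<in> \<O>" "inverse x \<in> \<O>" "x * inverse x = 1"
    by (simp_all add: val_ring_def v_inverse)
  then show "x \<in> \<U>" unfolding val_units_def by blast
qed

lemma ring_eq: "\<O> = \<U> \<union> \<MM>"
  by (auto simp: val_ring_def val_ideal_def units_iff)

lemma unit_ring [simp]: "x \<in> \<U> \<Longrightarrow> x \<in> \<O>"
  by (simp add: ring_eq)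

lemma ideal_ring [simp]: "x \<in> \<MM> \<Longrightarrow> x \<in> \<O>"
  by (simp add: ring_eq)

lemma ideal_not_unit: "x \<in> \<MM> \<Longrightarrow> x \<notin> \<U>"
  by (auto simp: val_ideal_def units_iff)

lemma ring_not_unit: "x \<in> \<O> \<Longrightarrow> x \<notin> \<U> \<Longrightarrow> x \<in> \<MM>"
  using ring_eq by blast

lemma unit_nonzero: "x \<in> \<U> \<Longrightarrow> x \<noteq> 0"
  by (simp add: units_iff)

lemma zero_ideal [simp]: "0 \<in> \<MM>"
  by (simp add: val_ideal_def)

lemma one_unit [simp]: "1 \<in> \<U>"
  by (simp add: units_iff)

lemma unit_mult [simp]: "x \<in> \<U> \<Longrightarrow> y \<in> \<U> \<Longrightarrow> x * y \<in> \<U>"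
  by (simp add: units_iff v_mult)

lemma unit_inverse [simp]: "x \<in> \<U> \<Longrightarrow> inverse x \<in> \<U>"
  by (simp add: units_iff v_inverse)

lemma unit_divide [simp]: "x \<in> \<U> \<Longrightarrow> y \<in> \<U> \<Longrightarrow> x / y \<in> \<U>"
  by (simp add: divide_inverse)

lemma unit_minus [simp]: "- x \<in> \<U> \<longleftrightarrow> x \<in> \<U>"
  by (simp add: units_iff)

lemma ideal_minus [simp]: "- x \<in> \<MM> \<longleftrightarrow> x \<in> \<MM>"
  by (simp add: val_ideal_def)

lemma ring_minus [simp]: "- x \<in> \<O> \<longleftrightarrow> x \<in> \<O>"
  by (simp add: val_ring_def)

lemma ideal_add [simp]: "x \<in> \<MM> \<Longrightarrow> y \<in> \<MM> \<Longrightarrow> x + y \<in> \<MM>"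
  using v_add[of x y] order.strict_trans2[of 0 "v x" "v (x + y)"] order.strict_trans2[of 0 "v y" "v (x + y)"]
  by (cases "x = 0 \<or> y = 0") (auto simp: val_ideal_def min_le_iff_disj)

lemma ring_add [simp]: "x \<in> \<O> \<Longrightarrow> y \<in> \<O> \<Longrightarrow> x + y \<in> \<O>"
  using v_add[of x y] order_trans[of 0 "v x" "v (x + y)"] order_trans[of 0 "v y" "v (x + y)"]
  by (cases "x = 0 \<or> y = 0") (auto simp: val_ring_def min_le_iff_disj)

lemma ring_mult [simp]: "x \<in> \<O> \<Longrightarrow> y \<in> \<O> \<Longrightarrow> x * y \<in> \<O>"
  by (cases "x = 0 \<or> y = 0") (auto simp: val_ring_def v_mult)

lemma unit_mult_ideal [simp]: "x \<in> \<U> \<Longrightarrow> y \<in> \<MM> \<Longrightarrow> x * y \<in> \<MM>"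
  by (cases "y = 0") (auto simp: val_ideal_def units_iff v_mult)

lemma ring_mult_ideal: "x \<in> \<O> \<Longrightarrow> y \<in> \<MM> \<Longrightarrow> x * y \<in> \<MM>"
  by (cases "x = 0 \<or> y = 0") (auto simp: val_ideal_def val_ring_def v_mult add_nonneg_pos)

lemma ideal_diff [simp]: "x \<in> \<MM> \<Longrightarrow> y \<in> \<MM> \<Longrightarrow> x - y \<in> \<MM>"
  using ideal_add[of x "- y"] by simp

lemma ring_diff [simp]: "x \<in> \<O> \<Longrightarrow> y \<in> \<O> \<Longrightarrow> x - y \<in> \<O>"
  using ring_add[of x "- y"] by simp

lemma unit_add_ideal [simp]:
  assumes "u \<in> \<U>" "m \<in> \<MM>"
  shows "u + m \<in> \<U>"
proof (rule ccontr)
  assume "u + m \<notin> \<U>"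
  moreover have "u + m \<in> \<O>" by (rule ring_add) (use assms in simp_all)
  ultimately have "u + m \<in> \<MM>" by (rule ring_not_unit[rotated])
  then have "(u + m) - m \<in> \<MM>" by (rule ideal_diff) (fact assms)
  then have "u \<in> \<MM>" by simp
  with assms show False using ideal_not_unit by blast
qed

lemma unit_diff_ideal [simp]: "u \<in> \<U> \<Longrightarrow> m \<in> \<MM> \<Longrightarrow> u - m \<in> \<U>"
  using unit_add_ideal[of u "- m"] by simp

lemma zero_ring [simp]: "0 \<in> \<O>"
  by simp

lemma one_ring [simp]: "1 \<in> \<O>"
  by simp

text \<open>Not declared earlier, because it makes the simplifier loop together with \<open>units_iff\<close>.\<close>

declare unit_nonzero [simp]

lemma unit_cancel [simp]:
  assumes "u \<in> \<U>"
  shows "u * inverse u = 1" "inverse u * u = 1" "u * (inverse u * x) = x" "inverse u * (u * x) = x"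
  using unit_nonzero[OF assms] by (simp_all flip: mult.assoc)

end


section \<open>Actions of the presented group\<close>

text \<open>
  The relations are imposed on maps of a set and evaluated at points, so that products need no
  bracketing and no membership in a carrier. Inverses are eliminated in favour of
  \<open>R(a)\<^sup>-\<^sup>1 = R(a\<^sup>-\<^sup>1)\<close>, \<open>S\<^sup>-\<^sup>1 = S\<close> and \<open>J\<^sup>-\<^sup>1 = J\<close>.
\<close>

locale gl2_action = valued_field v
  for v :: "'k::field \<Rightarrow> 'l::linordered_ab_group_add" +
  fixes t :: "'l \<Rightarrow> 'k"
    and reps :: "'k set"
    and r :: "'k \<Rightarrow> 'x \<Rightarrow> 'x"
    and s j :: "'x \<Rightarrow> 'x"
    and z :: "'k \<Rightarrow> 'x \<Rightarrow> 'x"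
  defines "z \<equiv> \<lambda>a p. j (r a (j (r a p)))"
  assumes t: "\<And>\<alpha>. \<alpha> \<in> value_monoid v \<Longrightarrow> t \<alpha> \<noteq> 0 \<and> v (t \<alpha>) = \<alpha>"
    and reps_units: "a \<in> reps \<Longrightarrow> a \<in> val_units v \<and> 1 - a \<in> val_units v"
    and reps_cover: "a \<in> val_units v \<Longrightarrow> 1 - a \<in> val_units v \<Longrightarrow> \<exists>b\<in>reps. a - b \<in> val_ideal v"
    and r_one [simp]: "r 1 p = p"
    and r_r: "a \<in> val_units v \<Longrightarrow> b \<in> val_units v \<Longrightarrow> r a (r b p) = r (a * b) p"
    and z_z: "a \<in> val_units v \<Longrightarrow> b \<in> val_units v \<Longrightarrow> z a (z b p) = z (a * b) p"
    and r_z: "a \<in> val_units v \<Longrightarrow> b \<in> val_units v \<Longrightarrow> r a (z b p) = z b (r a p)"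
    and s_z: "a \<in> val_units v \<Longrightarrow> s (z a p) = z a (s p)"
    and s_s [simp]: "s (s p) = p"
    and s_r: "\<alpha> \<in> value_monoid v - {0} \<Longrightarrow> a \<in> val_units v \<Longrightarrow>
      s (r (1 - a * t \<alpha>) (s (r (inverse (1 - a * t \<alpha>)) p)))
      = r a (s (r (1 - t \<alpha>) (s (r (inverse (1 - t \<alpha>)) (r (inverse a) p)))))"
    and s_r_s: "a \<in> reps \<Longrightarrow> s (r a (s p)) = r (1 - a) (s (r (a / (a - 1)) p))"
    and j_j [simp]: "j (j p) = p"
    and j_s: "j (s (j (s (j (s p))))) = p"
begin

lemma r_inverse [simp]: "a \<in> \<U> \<Longrightarrow> r a (r (inverse a) p) = p"
  by (simp add: r_r)

lemma r_inverse' [simp]: "a \<in> \<U> \<Longrightarrow> r (inverse a) (r a p) = p"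
  by (simp add: r_r)

text \<open>Acts as the translation by \<open>1 - u\<close>.\<close>

definition D :: "'k \<Rightarrow> 'x \<Rightarrow> 'x" where
  "D u p = s (r u (s (r (inverse u) p)))"

text \<open>Both branches stand for the translation by \<open>x\<close>. Two are needed:
  \<open>D (1 - x)\<close> requires \<open>1 - x\<close> to be a unit, and the conjugate of
  \<open>T 1 = s r (-1)\<close> by \<open>r x\<close> requires \<open>x\<close> to be one.\<close>

definition T :: "'k \<Rightarrow> 'x \<Rightarrow> 'x" where
  "T x = (if x \<in> \<U> then (\<lambda>p. r x (s (r (- inverse x) p))) else D (1 - x))"

section \<open>Conjugation and additivity of the translations\<close>

lemma T_ideal: "m \<in> \<MM> \<Longrightarrow> T m = D (1 - m)"
  by (simp add: T_def ideal_not_unit)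

lemma T_unit: "u \<in> \<U> \<Longrightarrow> T u p = r u (s (r (- inverse u) p))"
  by (simp add: T_def)

lemma T_0 [simp]: "T 0 p = p"
  by (simp add: T_ideal D_def)

lemma T_1: "T 1 p = s (r (- 1) p)"
  by (simp add: T_unit)

text \<open>The commutator identity [S, UW] = [S, U] U [S, W] U^-1; on translation lengths it reads
  1 - uw = (1 - u) + u (1 - w).\<close>

lemma D_mult:
  assumes "u \<in> \<U>" "w \<in> \<U>"
  shows "D (u * w) p = D u (r u (D w (r (inverse u) p)))"
  using assms by (simp add: D_def r_r inverse_mult_distrib mult.commute)

text \<open>A nonzero \<open>m\<close> is a unit multiple \<open>b * t \<alpha>\<close> with
  \<open>\<alpha> = v m\<close>. The relation for \<open>t \<alpha>\<close> then makes
  \<open>D (1 - m)\<close> and \<open>D (1 - a * m)\<close> conjugates of the same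
  \<open>D (1 - t \<alpha>)\<close>, by \<open>r b\<close> and \<open>r (a * b)\<close>.\<close>

lemma D_conj:
  assumes a: "a \<in> \<U>" and m: "m \<in> \<MM>"
  shows "r a (D (1 - m) p) = D (1 - a * m) (r a p)"
proof (cases "m = 0")
  case True
  then show ?thesis by (simp add: D_def)
next
  case False
  define \<alpha> where "\<alpha> = v m"
  have \<alpha>: "\<alpha> \<in> value_monoid v - {0}"
    using False m by (auto simp: \<alpha>_def value_monoid_def value_group_def val_ideal_def)
  then have t0: "t \<alpha> \<noteq> 0" "v (t \<alpha>) = \<alpha>" using t by auto
  define b where "b = m / t \<alpha>"
  have b: "b \<in> \<U>" and mb: "m = b * t \<alpha>"
    using False t0 by (auto simp: b_def units_iff divide_inverse v_mult v_inverse \<alpha>_def)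
  have eq: "D (1 - c * t \<alpha>) p = r c (D (1 - t \<alpha>) (r (inverse c) p))" if "c \<in> \<U>" for c p
    using s_r[OF \<alpha> that] by (simp add: D_def)
  have "inverse (a * b) * a = inverse b"
    using a b by (simp add: inverse_mult_distrib mult.assoc)
  then show ?thesis
    using eq[OF b, of p] eq[of "a * b" "r a p"] a b
    by (simp add: mb r_r mult.assoc del: inverse_mult_distrib)
qed

lemma T_conj:
  assumes a: "a \<in> \<U>" and x: "x \<in> \<O>"
  shows "r a (T x p) = T (a * x) (r a p)"
proof (cases "x \<in> \<U>")
  case True
  then have "inverse (a * x) * a = inverse x"
    using a by (simp add: inverse_mult_distrib mult.assoc)
  then show ?thesis using a True by (simp add: T_unit r_r del: inverse_mult_distrib)
next
  case False
  then have "x \<in> \<MM>" using x ring_not_unit by blast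
  then show ?thesis using a D_conj by (simp add: T_ideal)
qed

lemma T_add_ideal:
  assumes m: "m \<in> \<MM>" and n: "n \<in> \<MM>"
  shows "T m (T n p) = T (m + n) p"
proof -
  have u: "1 - m \<in> \<U>" using m by simp
  \<comment> \<open>Chosen so that (1 - m)(1 - n') = 1 - (m + n), which lets the cocycle identity
    turn a product into a sum.\<close>
  define n' where "n' = inverse (1 - m) * n"
  have n': "n' \<in> \<MM>" and nn: "(1 - m) * n' = n"
    using u n by (auto simp: n'_def)
  have "(1 - m) * (1 - n') = (1 - m) - (1 - m) * n'" by (simp add: right_diff_distrib)
  then have "(1 - m) * (1 - n') = 1 - (m + n)" by (simp add: nn)
  then have "T (m + n) p = D ((1 - m) * (1 - n')) p"
    using m n by (simp add: T_ideal)
  also have "\<dots> = D (1 - m) (r (1 - m) (D (1 - n') (r (inverse (1 - m)) p)))"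
    using u n' by (simp add: D_mult)
  also have "\<dots> = T m (T n p)"
    using u n' nn m n by (simp add: D_conj T_ideal)
  finally show ?thesis ..
qed

text \<open>\<open>T m\<close> is the product of the involution \<open>s\<close> and its conjugate
  by \<open>r (1 - m)\<close>, and a product of two involutions is inverted on conjugation by either
  of them.\<close>

lemma s_T_ideal:
  assumes m: "m \<in> \<MM>"
  shows "s (T m p) = T (- m) (s p)"
proof -
  have "T m (s (T m p)) = s p"
    using m by (simp add: T_ideal D_def)
  then have "T (- m) (s p) = T (- m) (T m (s (T m p)))" by simp
  then show ?thesis using m by (simp add: T_add_ideal)
qed

text \<open>Each of the two factors of \<open>T 1 = s r (-1)\<close> negates
  \<open>m\<close>.\<close>

lemma T_1_commute_ideal: "m \<in> \<MM> \<Longrightarrow> T m (T 1 p) = T 1 (T m p)"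
  by (simp add: T_1 T_conj s_T_ideal)

text \<open>The unit formula for \<open>T (1 + m)\<close> is \<open>s D (1 + m) r (-1)\<close>,
  whose middle factor is the translation by \<open>- m\<close>.\<close>

lemma T_1_add_ideal:
  assumes m: "m \<in> \<MM>"
  shows "T 1 (T m p) = T (1 + m) p"
proof -
  have u: "1 + m \<in> \<U>" using m by simp
  have "T (1 + m) p = s (D (1 + m) (r (- 1) p))"
    using u by (simp add: T_unit D_def r_r)
  also have "\<dots> = s (T (- m) (r (- 1) p))" using m by (simp add: T_ideal)
  also have "\<dots> = T 1 (T m p)" using m by (simp add: T_1 T_conj)
  finally show ?thesis ..
qed

lemma T_unit_add_ideal:
  assumes u: "u \<in> \<U>" and m: "m \<in> \<MM>"
  shows "T u (T m p) = T (u + m) p" and "T m (T u p) = T (u + m) p"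
proof -
  \<comment> \<open>Conjugation by \<open>r u\<close> reduces everything to the case
    \<open>u = 1\<close>.\<close>
  define n where "n = inverse u * m"
  have n: "n \<in> \<MM>" "m = u * n" using u m by (auto simp: n_def)
  define q where "q = r (inverse u) p"
  have q: "p = r u q" using u by (simp add: q_def)
  have "r u (T 1 (T n q)) = r u (T (1 + n) q)" using n by (simp add: T_1_add_ideal)
  then show 1: "T u (T m p) = T (u + m) p"
    using u n by (simp add: q T_conj algebra_simps)
  have "r u (T n (T 1 q)) = r u (T 1 (T n q))" using n by (simp add: T_1_commute_ideal)
  then show "T m (T u p) = T (u + m) p"
    using u n 1 by (simp add: q T_conj)
qed

text \<open>The relation for the residue representatives gives the case of \<open>b\<close> in
  \<open>reps\<close>; the cocycle identity spreads it over the coset of \<open>b\<close> modulo the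
  maximal ideal.\<close>

lemma D_eq_T:
  assumes u: "u \<in> \<U>"
  shows "D u p = T (1 - u) p"
proof (cases "1 - u \<in> \<U>")
  case False
  then have "1 - u \<in> \<MM>" using u ring_not_unit[of "1 - u"] by simp
  then show ?thesis by (simp add: T_ideal)
next
  case True
  then obtain b where b: "b \<in> reps" "u - b \<in> \<MM>" using reps_cover u by blast
  have bu: "b \<in> \<U>" "1 - b \<in> \<U>" using reps_units b by auto
  have D_rep: "D b p = T (1 - b) p" for p
  proof -
    have "- (1 - b) \<in> \<U>" using bu by (simp only: unit_minus)
    then have b1: "b - 1 \<in> \<U>" by simp
    have "b / (b - 1) * inverse b = - inverse (1 - b)"
      using bu by (simp add: divide_inverse inverse_minus_eq[symmetric] del: inverse_minus_eq)
    then show ?thesis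
      using bu b1 r_r[of "b / (b - 1)" "inverse b" p] by (simp add: D_def s_r_s[OF b(1)] T_unit)
  qed
  \<comment> \<open>Solves \<open>u = b * (1 - m)\<close>; it lies in the ideal because
    \<open>u\<close> and \<open>b\<close> have the same residue.\<close>
  define m where "m = inverse b * (b - u)"
  have "- (u - b) \<in> \<MM>" using b by (simp only: ideal_minus)
  then have m: "m \<in> \<MM>" using bu by (simp add: m_def)
  have um: "u = b * (1 - m)" using bu by (simp add: m_def right_diff_distrib)
  have "D u p = D b (r b (D (1 - m) (r (inverse b) p)))"
    using bu m by (simp add: um D_mult)
  also have "\<dots> = T (1 - b) (T (b * m) p)"
    using bu m by (simp add: D_rep D_conj T_ideal)
  also have "\<dots> = T (1 - u) p"
    using bu m by (simp add: T_unit_add_ideal um algebra_simps)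
  finally show ?thesis .
qed

text \<open>Both sides are \<open>D (- 1)\<close>, the square of \<open>s r (-1)\<close>;
  \<open>D_eq_T\<close> covers every residue characteristic.\<close>

lemma T_1_double: "T 1 (T 1 p) = T 2 p"
  using D_eq_T[of "- 1" p] by (simp add: T_1 D_def)

text \<open>Adding \<open>1\<close> to a unit \<open>x\<close>: if \<open>x \<equiv> 1\<close> modulo \<open>\<MM>\<close> this is the doubling of \<open>1\<close> up to the
  ideal; otherwise \<open>D\<close> is multiplied out at \<open>-x = (1 - x) \<cdot> w\<close>.\<close>

lemma T_unit_add_1:
  assumes x: "x \<in> \<U>"
  shows "T x (T 1 p) = T (x + 1) p"
proof (cases "1 - x \<in> \<U>")
  case False
  then have "1 - x \<in> \<MM>" using x ring_not_unit[of "1 - x"] by simp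
  then have m: "x - 1 \<in> \<MM>" using ideal_minus[of "1 - x"] by simp
  have "T x (T 1 p) = T (x - 1) (T 1 (T 1 p))"
    using m T_unit_add_ideal(2)[of 1 "x - 1"] by simp
  also have "\<dots> = T (x - 1) (T 2 p)" by (simp add: T_1_double)
  also have "\<dots> = T (x + 1) p"
  \<comment> \<open>In residue characteristic 2 the element 2 lies in the maximal ideal, and
    additivity on the ideal applies instead.\<close>
  proof (cases "(2::'k) \<in> \<U>")
    case True
    then show ?thesis using m T_unit_add_ideal(2)[OF True m] by (simp add: algebra_simps)
  next
    case False
    moreover have "(2::'k) \<in> \<O>" using ring_add[OF one_ring one_ring] by simp
    ultimately have "(2::'k) \<in> \<MM>" using ring_not_unit by blast
    then show ?thesis using m by (simp add: T_add_ideal algebra_simps)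
  qed
  finally show ?thesis .
next
  case u: True
  define w where "w = - x / (1 - x)"
  have w: "w \<in> \<U>" using x u by (simp add: w_def)
  have uw: "(1 - x) * w = - x" using unit_nonzero[OF u] by (simp add: w_def)
  have "T (x + 1) p = D ((1 - x) * w) p"
    unfolding uw using x by (simp add: D_eq_T add.commute)
  also have "\<dots> = T x (T ((1 - x) * (1 - w)) p)"
    unfolding D_mult[OF u w] using x u w by (simp add: D_eq_T T_conj)
  also have "(1 - x) * (1 - w) = 1" using uw by (simp add: algebra_simps)
  finally show ?thesis ..
qed

lemma T_add:
  assumes x: "x \<in> \<O>" and y: "y \<in> \<O>"
  shows "T x (T y p) = T (x + y) p"
proof (cases "x \<in> \<U> \<and> y \<in> \<U>")
  case True
  \<comment> \<open>Conjugation by \<open>r y\<close> reduces the sum of two units to adding 1 to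
    the unit \<open>x / y\<close>.\<close>
  define q where "q = r (inverse y) p"
  have q: "p = r y q" using True by (simp add: q_def)
  have "r y (T (x / y) (T 1 q)) = r y (T (x / y + 1) q)"
    using True by (simp add: T_unit_add_1)
  then show ?thesis using True by (simp add: T_conj q distrib_left)
next
  case False
  then show ?thesis
    using x y by (auto simp: ring_eq T_unit_add_ideal T_add_ideal add.commute)
qed

section \<open>Commutation rules for \<open>s\<close>, \<open>j\<close> and the central
  elements\<close>

lemma s_eq: "s p = T 1 (r (- 1) p)"
  by (simp add: T_1 r_r)

lemma T_s: "x \<in> \<O> \<Longrightarrow> T x (s p) = r (- 1) (T (- 1 - x) p)"
  by (simp add: s_eq T_conj T_add add.commute)

lemma j_z:
  assumes "a \<in> \<U>"
  shows "j (z a p) = z a (j p)"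
proof -
  \<comment> \<open>Conjugating \<open>z a = j r j r\<close> by \<open>r a\<close> rewrites it as
    \<open>r j r j\<close>; comparing the two forms yields commutation with
    \<open>j\<close>.\<close>
  have "r a (z a (r (inverse a) (j p))) = z a (j p)" using assms by (simp add: r_z)
  then show ?thesis using assms by (simp add: z_def)
qed

lemma j_r: "a \<in> \<U> \<Longrightarrow> j (r a p) = z a (r (inverse a) (j p))"
  by (simp add: z_def)

lemma r_j: "a \<in> \<U> \<Longrightarrow> r a (j p) = j (z a (r (inverse a) p))"
  by (simp add: z_def)

lemma T_z:
  assumes "a \<in> \<U>" "x \<in> \<O>"
  shows "T x (z a p) = z a (T x p)"
proof -
  have "D u (z a p) = z a (D u p)" if "u \<in> \<U>" for u p
    using that assms by (simp add: D_def r_z s_z)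
  moreover have "x \<in> \<MM>" if "x \<notin> \<U>" using assms that ring_not_unit by blast
  ultimately show ?thesis using assms by (auto simp: T_def r_z s_z)
qed

text \<open>For involutions, the relation (J S)^3 = 1 is the braid relation.\<close>

lemma j_s_j: "j (s (j p)) = s (j (s p))"
  using j_s[of "s (j (s p))"] by (metis j_j s_s j_s)

lemma j_s': "j (s p) = s (j (s (j p)))"
  using j_s_j[of "j p"] by simp

section \<open>Normal forms and their stability under right multiplication\<close>

inductive_set big_cell :: "('x \<Rightarrow> 'x) set" where
  "\<lbrakk>d \<in> \<U>; b \<in> \<O>; a \<in> \<U>; y \<in> \<O>\<rbrakk> \<Longrightarrow> (\<lambda>p. z d (T b (r a (j (T y p))))) \<in> big_cell"

text \<open>As a matrix, \<open>j T x j\<close> is lower unipotent with entry \<open>x\<close>. Thus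
  the lower-left entry is in the maximal ideal here, while on \<open>big_cell\<close> it is a
  unit.\<close>

inductive_set small_cell :: "('x \<Rightarrow> 'x) set" where
  "\<lbrakk>d \<in> \<U>; b \<in> \<O>; a \<in> \<U>; x \<in> \<MM>\<rbrakk> \<Longrightarrow> (\<lambda>p. z d (T b (r a (j (T x (j p)))))) \<in> small_cell"

lemma z_1 [simp]: "z 1 p = p"
  by (simp add: z_def)

lemma big_cellI: "y \<in> \<O> \<Longrightarrow> (\<lambda>p. j (T y p)) \<in> big_cell"
  using big_cell.intros[of 1 0 1 y] by simp

lemma small_cellI: "x \<in> \<MM> \<Longrightarrow> (\<lambda>p. j (T x (j p))) \<in> small_cell"
  using small_cell.intros[of 1 0 1 x] by simp

text \<open>With the next two lemmas: left factors from the subgroup B are absorbed, so right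
  multiplication need only be computed on the part from \<open>j\<close> onwards.\<close>

lemma cell_z:
  assumes "d \<in> \<U>"
  shows "f \<in> big_cell \<Longrightarrow> (\<lambda>p. z d (f p)) \<in> big_cell"
    and "f \<in> small_cell \<Longrightarrow> (\<lambda>p. z d (f p)) \<in> small_cell"
  using assms
  by (auto elim!: big_cell.cases small_cell.cases simp: z_z intro!: big_cell.intros small_cell.intros)

lemma cell_T:
  assumes "b \<in> \<O>"
  shows "f \<in> big_cell \<Longrightarrow> (\<lambda>p. T b (f p)) \<in> big_cell"
    and "f \<in> small_cell \<Longrightarrow> (\<lambda>p. T b (f p)) \<in> small_cell"
  using assms
  by (auto elim!: big_cell.cases small_cell.cases simp: T_z T_add intro!: big_cell.intros small_cell.intros)

lemma cell_r:
  assumes "a \<in> \<U>"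
  shows "f \<in> big_cell \<Longrightarrow> (\<lambda>p. r a (f p)) \<in> big_cell"
    and "f \<in> small_cell \<Longrightarrow> (\<lambda>p. r a (f p)) \<in> small_cell"
  using assms
  by (auto elim!: big_cell.cases small_cell.cases simp: r_z r_r T_conj intro!: big_cell.intros small_cell.intros)

lemmas cell_left = cell_z cell_T cell_r

text \<open>The factor \<open>r c\<close> travels left, rescaling \<open>y\<close> and becoming
  \<open>z c r (inverse c)\<close> when it passes \<open>j\<close>, until it is absorbed.\<close>

lemma big_cell_r:
  assumes "f \<in> big_cell" and c: "c \<in> \<U>"
  shows "(\<lambda>p. f (r c p)) \<in> big_cell"
  using assms(1)
proof cases
  case (1 d b a y)
  have "T y (r c p) = r c (T (inverse c * y) p)" for p
    using 1 c by (simp add: T_conj)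
  then have "f (r c p) = z d (T b (r a (z c (r (inverse c) (j (T (inverse c * y) p))))))" for p
    using 1 c by (simp add: j_r)
  moreover have "(\<lambda>p. z d (T b (r a (z c (r (inverse c) (j (T (inverse c * y) p))))))) \<in> big_cell"
    using 1 c by (intro cell_left big_cellI) auto
  ultimately show ?thesis by (simp only:)
qed

lemma big_cell_s:
  assumes "f \<in> big_cell"
  shows "(\<lambda>p. f (s p)) \<in> big_cell"
  using assms
proof cases
  case (1 d b a y)
  have "f (s p) = z d (T b (r a (z (- 1) (r (- 1) (j (T (- 1 - y) p))))))" for p
    using 1 by (simp add: T_s j_r)
  moreover have "(\<lambda>p. z d (T b (r a (z (- 1) (r (- 1) (j (T (- 1 - y) p))))))) \<in> big_cell"
    using 1 by (intro cell_left big_cellI) auto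
  ultimately show ?thesis by (simp only:)
qed

text \<open>Writing \<open>T y = r y s r w\<close> exposes \<open>j s j\<close> between diagonal
  factors; the braid relation replaces it by \<open>s j s\<close>, with a single
  \<open>j\<close>.\<close>

lemma lower_unit_big_cell:
  assumes y: "y \<in> \<U>"
  shows "(\<lambda>p. j (T y (j p))) \<in> big_cell"
proof -
  define w where "w = - inverse y"
  have w: "w \<in> \<U>" "inverse w = - y" using y by (simp_all add: w_def)
  have "j (T y (j p)) = z y (r (inverse y) (z w (T 1 (r (- 1) (j (s (r (- y) p)))))))" for p
  proof -
    have "j (T y (j p)) = z y (r (inverse y) (j (s (r w (j p)))))"
      using y by (simp add: T_unit j_r w_def)
    also have "r w (j p) = j (z w (r (- y) p))" using r_j[of w p] w by simp
    also have "j (s (j (z w (r (- y) p)))) = s (j (s (z w (r (- y) p))))" by (rule j_s_j)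
    also have "\<dots> = z w (T 1 (r (- 1) (j (s (r (- y) p)))))"
      using w by (simp add: s_z j_z s_eq[symmetric])
    finally show ?thesis .
  qed
  moreover have "(\<lambda>p. z y (r (inverse y) (z w (T 1 (r (- 1) (j (s (r (- y) p)))))))) \<in> big_cell"
    \<comment> \<open>The core is \<open>j = j T 0\<close>, multiplied on the right by
      \<open>s\<close> and then by \<open>r (- y)\<close>.\<close>
    using y w big_cell_r[OF big_cell_s[OF big_cellI[of 0]], of "- y"] by (intro cell_left) auto
  ultimately show ?thesis by (simp only:)
qed

lemma big_cell_j:
  assumes "f \<in> big_cell"
  shows "(\<lambda>p. f (j p)) \<in> big_cell \<union> small_cell"
  using assms
proof cases
  case (1 d b a y)
  show ?thesis
  proof (cases "y \<in> \<U>")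
    case True
    then show ?thesis unfolding 1 using 1 by (intro UnI1 cell_left lower_unit_big_cell)
  next
    case False
    then show ?thesis unfolding 1 using 1 by (intro UnI2 cell_left small_cellI ring_not_unit)
  qed
qed

lemma small_cell_r:
  assumes "f \<in> small_cell" and c: "c \<in> \<U>"
  shows "(\<lambda>p. f (r c p)) \<in> small_cell"
  using assms(1)
proof cases
  case (1 d b a x)
  have "T x (r (inverse c) p) = r (inverse c) (T (c * x) p)" for p
    using 1 c by (simp add: T_conj)
  then have "f (r c p) = z d (T b (r a (z c (z (inverse c) (r c (j (T (c * x) (j p))))))))" for p
    using 1 c by (simp add: j_r T_z j_z)
  moreover have "(\<lambda>p. z d (T b (r a (z c (z (inverse c) (r c (j (T (c * x) (j p))))))))) \<in> small_cell"
    using 1 c by (intro cell_left small_cellI) auto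
  ultimately show ?thesis by (simp only:)
qed

lemma small_cell_j:
  assumes "f \<in> small_cell"
  shows "(\<lambda>p. f (j p)) \<in> big_cell"
  using assms by cases (auto intro!: big_cell.intros)

text \<open>The identity \<open>J S = S J S J\<close> moves the product through the big cell.\<close>

lemma small_cell_s:
  assumes "f \<in> small_cell"
  shows "(\<lambda>p. f (s p)) \<in> big_cell \<union> small_cell"
  using assms
proof cases
  case (1 d b a x)
  define g where "g = (\<lambda>p. j (T (- 1 - x) (j p)))"
  have g: "g \<in> big_cell"
    \<comment> \<open>Since \<open>x\<close> is in the maximal ideal, \<open>- 1 - x\<close> is a
      unit.\<close>
    unfolding g_def using 1 by (intro lower_unit_big_cell) auto
  define h where "h = (\<lambda>p. z d (T b (r a (z (- 1) (r (- 1) (g p))))))"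
  have "h \<in> big_cell"
    unfolding h_def using 1 g by (intro cell_left) auto
  moreover have "f (s p) = h (s (j p))" for p
    using 1 by (simp add: h_def g_def j_s'[of p] T_s j_r)
  ultimately show ?thesis using big_cell_j[OF big_cell_s] by presburger
qed

end

section \<open>The matrix of a word\<close>

definition mat2 :: "'k::field \<Rightarrow> 'k \<Rightarrow> 'k \<Rightarrow> 'k \<Rightarrow> 'k^2^2" where
  "mat2 a b c d = vector [vector [a, b], vector [c, d]]"

lemma mat2_nth [simp]:
  "mat2 a b c d $ 1 $ 1 = a" "mat2 a b c d $ 1 $ 2 = b"
  "mat2 a b c d $ 2 $ 1 = c" "mat2 a b c d $ 2 $ 2 = d"
  by (simp_all add: mat2_def)

lemma mat2_eq_iff: "mat2 a b c d = mat2 a' b' c' d' \<longleftrightarrow> a = a' \<and> b = b' \<and> c = c' \<and> d = d'"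
  by (metis mat2_nth)

lemma mat2_mult:
  "mat2 a b c d ** mat2 a' b' c' d' =
     mat2 (a * a' + b * c') (a * b' + b * d') (c * a' + d * c') (c * b' + d * d')"
  by (simp add: vec_eq_iff forall_2 matrix_matrix_mult_def sum_2)

lemma mat_1_eq_mat2: "mat 1 = mat2 1 0 0 1"
  by (simp add: vec_eq_iff forall_2 mat_def)

lemma mat2_surj: "\<exists>a b c d. M = mat2 a b c d"
  by (rule exI[of _ "M $ 1 $ 1"], rule exI[of _ "M $ 1 $ 2"], rule exI[of _ "M $ 2 $ 1"],
      rule exI[of _ "M $ 2 $ 2"]) (simp add: vec_eq_iff forall_2)

lemma det_mat2: "det (mat2 a b c d) = a * d - b * c"
  by (simp add: det_2)

text \<open>The exponent is ignored for \<open>Gen_S\<close> and \<open>Gen_J\<close> because their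
  matrices are involutions.\<close>

fun letter_matrix :: "'k::field gl2_gen \<times> bool \<Rightarrow> 'k^2^2" where
  "letter_matrix (Gen_R a, e) = mat2 (if e then a else inverse a) 0 0 1"
| "letter_matrix (Gen_S, e) = mat2 (-1) 1 0 1"
| "letter_matrix (Gen_J, e) = mat2 0 (-1) (-1) 0"

lemma letter_matrix_gen: "letter_matrix (g, True) = gl2_matrix g"
  by (cases g) (simp_all add: mat2_def)

fun word_matrix :: "'k::field gl2_gen word \<Rightarrow> 'k^2^2" where
  "word_matrix [] = mat2 1 0 0 1"
| "word_matrix (l # w) = letter_matrix l ** word_matrix w"

lemma word_matrix_append [simp]: "word_matrix (u @ w) = word_matrix u ** word_matrix w"
  by (induction u) (simp_all add: matrix_mul_assoc flip: mat_1_eq_mat2)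

lemma word_matrix_simps [simp]:
  "word_matrix (word_R a) = mat2 a 0 0 1"
  "word_matrix (inv_word (word_R a)) = mat2 (inverse a) 0 0 1"
  "word_matrix word_S = mat2 (-1) 1 0 1"
  "word_matrix (inv_word word_S) = mat2 (-1) 1 0 1"
  "word_matrix word_J = mat2 0 (-1) (-1) 0"
  "word_matrix (word_Z a) = mat2 a 0 0 a"
  "word_matrix (inv_word (word_Z a)) = mat2 (inverse a) 0 0 (inverse a)"
  by (simp_all add: word_R_def word_S_def word_J_def word_Z_def inv_word_def mat2_mult)

lemma inv_word_inv_word [simp]: "inv_word (inv_word w) = w"
  by (induction w) (auto simp: inv_word_def)

lemma word_class_eq_iff:
  "u \<in> words X \<Longrightarrow> word_class X E u = word_class X E w \<longleftrightarrow> (u, w) \<in> word_cong X E"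
  unfolding word_class_def using equiv_class_eq_iff[OF equiv_word_cong] word_cong_words word_cong.refl
  by (metis Image_singleton_iff equiv_class_eq[OF equiv_word_cong])

section \<open>Matrices with entries in the valuation ring\<close>

context valued_field
begin

lemma mat2_over_iff: "mat2 a b c d \<in> mat2_over \<O> \<longleftrightarrow> a \<in> \<O> \<and> b \<in> \<O> \<and> c \<in> \<O> \<and> d \<in> \<O>"
  by (auto simp: mat2_over_def forall_2)

lemma mat2_over_mult: "M \<in> mat2_over \<O> \<Longrightarrow> N \<in> mat2_over \<O> \<Longrightarrow> M ** N \<in> mat2_over \<O>"
  by (simp add: mat2_over_def matrix_matrix_mult_def sum_2)

lemma GL2_mult:
  assumes "M \<in> carrier (GL2 \<O>)" "N \<in> carrier (GL2 \<O>)"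
  shows "M ** N \<in> carrier (GL2 \<O>)"
proof -
  obtain M' N' where
    "M' \<in> mat2_over \<O>" "M ** M' = mat 1" "M' ** M = mat 1"
    "N' \<in> mat2_over \<O>" "N ** N' = mat 1" "N' ** N = mat 1"
    using assms by (auto simp: GL2_def)
  moreover from this have "(M ** N) ** (N' ** M') = mat 1" "(N' ** M') ** (M ** N) = mat 1"
    by (metis matrix_mul_assoc matrix_mul_rid)+
  ultimately show ?thesis
    using assms by (auto simp: GL2_def mat2_over_mult intro!: bexI[of _ "N' ** M'"])
qed

lemma GL2_det:
  assumes "mat2 a b c d \<in> carrier (GL2 \<O>)"
  shows "a * d - b * c \<in> \<U>"
proof -
  obtain N where N: "N \<in> mat2_over \<O>" "mat2 a b c d ** N = mat 1"
    using assms by (auto simp: GL2_def)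
  obtain a' b' c' d' where N': "N = mat2 a' b' c' d'" using mat2_surj by blast
  have "(a * d - b * c) * (a' * d' - b' * c') = 1"
    using N(2) by (metis N' det_I det_mat2 det_mul)
  moreover have "a * d - b * c \<in> \<O>" "a' * d' - b' * c' \<in> \<O>"
    using assms N(1) by (simp_all add: GL2_def N' mat2_over_iff)
  ultimately show ?thesis unfolding val_units_def by blast
qed

lemma letter_matrix_cancel:
  assumes "g \<in> gl2_gens v"
  shows "letter_matrix (g, e) ** letter_matrix (g, \<not> e) = mat2 1 0 0 1"
  using assms by (cases g; cases e) (auto simp: gl2_gens_def mat2_mult)

lemma letter_matrix_over:
  assumes "g \<in> gl2_gens v"
  shows "letter_matrix (g, e) \<in> mat2_over \<O>"
  using assms by (cases g) (auto simp: gl2_gens_def mat2_over_iff)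

lemma word_matrix_GL2:
  assumes "w \<in> words (gl2_gens v)"
  shows "word_matrix w \<in> carrier (GL2 \<O>)"
  using assms
proof (induction w)
  case Nil
  have "mat 1 \<in> carrier (GL2 \<O>)"
    by (auto simp: GL2_def mat_1_eq_mat2 mat2_over_iff mat2_mult intro!: bexI[of _ "mat2 1 0 0 1"])
  then show ?case by (simp add: mat_1_eq_mat2)
next
  case (Cons l w)
  obtain g e where l: "l = (g, e)" by force
  have g: "g \<in> gl2_gens v" "w \<in> words (gl2_gens v)" using Cons.prems by (auto simp: words_def l)
  have "letter_matrix (g, e) \<in> carrier (GL2 \<O>)"
    using letter_matrix_cancel[OF g(1), of e] letter_matrix_cancel[OF g(1), of "\<not> e"]
      letter_matrix_over[OF g(1)]
    by (auto simp: GL2_def mat_1_eq_mat2 intro!: bexI[of _ "letter_matrix (g, \<not> e)"])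
  then show ?case using Cons.IH g by (simp add: l GL2_mult)
qed

end


section \<open>The presented group and its action on itself\<close>

locale gl2_presentation = valued_field v
  for v :: "'k::field \<Rightarrow> 'l::linordered_ab_group_add" +
  fixes t :: "'l \<Rightarrow> 'k"
    and reps :: "'k set"
  assumes t_value: "\<And>\<alpha>. \<alpha> \<in> value_monoid v \<Longrightarrow> t \<alpha> \<in> val_ring v - {0} \<and> v (t \<alpha>) = \<alpha>"
    and reps_subset: "reps \<subseteq> val_units v - {1 + m | m. m \<in> val_ideal v}"
    and reps_bij: "bij_betw (residue_class v) reps
           (residue_field v - {residue_class v 0, residue_class v 1})"
begin

abbreviation "X \<equiv> gl2_gens v"
abbreviation "E \<equiv> gl2_rels v t reps"
abbreviation "P \<equiv> presented_group X E"
abbreviation "cls \<equiv> word_class X E"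

section \<open>Residue representatives, and validity of the relations for matrices\<close>

lemma t_ideal: "\<alpha> \<in> value_monoid v - {0} \<Longrightarrow> t \<alpha> \<in> \<MM> \<and> t \<alpha> \<noteq> 0"
  using t_value[of \<alpha>] by (auto simp: value_monoid_def val_ideal_def)

lemma reps_unit:
  assumes "a \<in> reps"
  shows "a \<in> \<U> \<and> 1 - a \<in> \<U>"
proof -
  have a: "a \<in> \<U>" "\<And>m. m \<in> \<MM> \<Longrightarrow> a \<noteq> 1 + m" using assms reps_subset by auto
  have "1 - a \<notin> \<MM>"
  proof
    assume "1 - a \<in> \<MM>"
    then have "- (1 - a) \<in> \<MM>" by (simp only: ideal_minus)
    from a(2)[OF this] show False by simp
  qed
  then show ?thesis using a(1) ring_not_unit[of "1 - a"] by auto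
qed

lemma residue_class_eqD:
  assumes "residue_class v a = residue_class v b"
  shows "a - b \<in> \<MM>"
proof -
  have "a \<in> residue_class v a" by (auto simp: residue_class_def intro!: exI[of _ 0])
  then show ?thesis unfolding assms by (auto simp: residue_class_def)
qed

lemma reps_cover:
  assumes a: "a \<in> \<U>" "1 - a \<in> \<U>"
  shows "\<exists>b\<in>reps. a - b \<in> \<MM>"
proof -
  have "residue_class v a \<noteq> residue_class v 0"
    using residue_class_eqD[of a 0] a ideal_not_unit by auto
  moreover have "residue_class v a \<noteq> residue_class v 1"
    using residue_class_eqD[of 1 a] a ideal_not_unit by fastforce
  ultimately have "residue_class v a \<in> residue_class v ` reps"
    using a reps_bij by (simp add: bij_betw_def residue_field_def)
  then show ?thesis using residue_class_eqD by blast
qed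

lemma word_in_words [simp]:
  "a \<in> \<U> \<Longrightarrow> word_R a \<in> words X" "word_S \<in> words X" "word_J \<in> words X"
  "a \<in> \<U> \<Longrightarrow> word_Z a \<in> words X"
  by (auto simp: word_R_def word_S_def word_J_def word_Z_def words_def gl2_gens_def)

text \<open>Soundness of the presentation. The delicate cases involve inverses of
  \<open>1 - a * t \<alpha>\<close>, \<open>1 - t \<alpha>\<close> and \<open>a - 1\<close>, which
  are units by the choice of \<open>t\<close> and \<open>reps\<close>.\<close>

lemma rel_matrix:
  assumes "(l, w) \<in> E"
  shows "word_matrix l = word_matrix w"
  using assms
proof cases
  case (S_R \<alpha> a)
  have "1 - a * t \<alpha> \<in> \<U>" "1 - t \<alpha> \<in> \<U>" "a \<in> \<U>" using S_R t_ideal by auto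
  then show ?thesis
    using S_R by (simp add: commutator_word_def mat2_mult mat2_eq_iff)
next
  case (S_R_S a)
  have "- (1 - a) \<in> \<U>" using S_R_S reps_unit by (simp only: unit_minus)
  from unit_nonzero[OF this] show ?thesis
    using S_R_S by (simp add: mat2_mult mat2_eq_iff field_simps)
qed (auto simp: commutator_word_def mat2_mult mat2_eq_iff field_simps)

lemma word_cong_matrix:
  assumes "(u, w) \<in> word_cong X E"
  shows "word_matrix u = word_matrix w"
  using assms
proof (induction rule: word_cong.induct)
  case (cancel g p q e)
  have "word_matrix [(g, e), (g, \<not> e)] = mat 1"
    using letter_matrix_cancel[OF cancel(1), of e]
    by (simp add: mat_1_eq_mat2[symmetric])
  then show ?case by (simp only: word_matrix_append matrix_mul_lid)
qed (simp_all add: rel_matrix)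

text \<open>Left multiplication, extended by the identity to sets of words that are not classes.\<close>

definition act :: "'k gl2_gen word \<Rightarrow> 'k gl2_gen word set \<Rightarrow> 'k gl2_gen word set" where
  "act w A = (if A \<in> carrier P then cls w \<otimes>\<^bsub>P\<^esub> A else A)"

lemma cls_carrier [simp]: "w \<in> words X \<Longrightarrow> cls w \<in> carrier P"
  by (simp add: carrier_presented_group)

lemma act_append: "u \<in> words X \<Longrightarrow> w \<in> words X \<Longrightarrow> act (u @ w) A = act u (act w A)"
  using group.is_monoid[OF group_presented_group, of X E]
  by (simp add: act_def monoid.m_closed monoid.m_assoc flip: presented_group_mult)

lemma act_Nil [simp]: "act [] A = A"
  using group.is_monoid[OF group_presented_group, of X E]
  by (simp add: act_def monoid.l_one flip: one_presented_group)

lemma act_cong: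
  assumes "(u, w) \<in> word_cong X E"
  shows "act u = act w"
proof -
  have "cls u = cls w" using assms word_cong_words word_class_eq_iff by blast
  then show ?thesis by (simp add: act_def fun_eq_iff)
qed

text \<open>The left regular action is faithful: evaluate at the class of the empty word.\<close>

lemma cong_if_act_eq:
  assumes "u \<in> words X" "w \<in> words X" "act u = act w"
  shows "(u, w) \<in> word_cong X E"
proof -
  have "act x (cls []) = cls x" if "x \<in> words X" for x
    using that by (simp add: act_def presented_group_mult)
  then have "cls u = cls w" using assms by metis
  then show ?thesis using assms by (simp add: word_class_eq_iff)
qed

lemma act_rel: "(l, w) \<in> E \<Longrightarrow> l \<in> words X \<Longrightarrow> w \<in> words X \<Longrightarrow> act l = act w"
  using word_cong.rel[of l w E X "[]" "[]"] by (intro act_cong) simp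

lemma act_inv_left [simp]: "w \<in> words X \<Longrightarrow> act (inv_word w) (act w A) = A"
  using act_cong[OF inv_word_cong[of w X E]] by (simp add: inv_word_words flip: act_append)

lemma act_inv_right [simp]: "w \<in> words X \<Longrightarrow> act w (act (inv_word w) A) = A"
  using act_inv_left[of "inv_word w" A] by (simp add: inv_word_words del: act_inv_left)

lemma act_commutator:
  assumes "u \<in> words X" "w \<in> words X" "(commutator_word u w, []) \<in> E"
  shows "act u (act w A) = act w (act u A)"
proof -
  \<comment> \<open>The point is chosen so that the two inverse words of the commutator
    cancel.\<close>
  have "act (commutator_word u w) (act w (act u A)) = act w (act u A)"
    using assms by (subst act_rel[OF assms(3)]) (auto simp: commutator_word_def inv_word_words)
  then show ?thesis
    using assms by (simp add: commutator_word_def act_append inv_word_words)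
qed

section \<open>The relations as identities of the action\<close>

lemma act_R_1 [simp]: "act (word_R 1) A = A"
  by (simp add: word_R_def)

text \<open>The relation is imposed only away from 1; the remaining cases hold because
  \<open>word_R 1\<close> is empty. The lemmas on \<open>word_Z\<close> below are completed in the
  same way.\<close>

lemma act_R_R:
  assumes "a \<in> \<U>" "b \<in> \<U>"
  shows "act (word_R a) (act (word_R b) A) = act (word_R (a * b)) A"
proof (cases "a = 1 \<or> b = 1")
  case False
  then show ?thesis
    using assms act_rel[OF gl2_rels.R_mult[of a v b t reps]] by (simp flip: act_append)
qed auto

lemma act_J_J [simp]: "act word_J (act word_J A) = A"
  using act_rel[OF gl2_rels.J_square[of v t reps]] by (simp flip: act_append)

lemma act_S_S [simp]: "act word_S (act word_S A) = A"
  using act_rel[OF gl2_rels.S_square[of v t reps]] by (simp flip: act_append)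

lemma act_Z:
  "a \<in> \<U> \<Longrightarrow> act word_J (act (word_R a) (act word_J (act (word_R a) A))) = act (word_Z a) A"
  by (simp add: word_Z_def flip: act_append) (simp add: act_append)

lemma act_inv_R [simp]:
  assumes "a \<in> \<U>"
  shows "act (inv_word (word_R a)) A = act (word_R (inverse a)) A"
  using assms act_inv_left[of "word_R a" "act (word_R (inverse a)) A"] by (simp add: act_R_R)

lemma act_inv_S [simp]: "act (inv_word word_S) A = act word_S A"
  using act_inv_left[of word_S "act word_S A"] by simp

lemma act_inv_J [simp]: "act (inv_word word_J) A = act word_J A"
  using act_inv_left[of word_J "act word_J A"] by simp

lemma act_Z_Z:
  assumes "a \<in> \<U>" "b \<in> \<U>"
  shows "act (word_Z a) (act (word_Z b) A) = act (word_Z (a * b)) A"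
proof (cases "a = 1 \<or> b = 1")
  case False
  then show ?thesis
    using assms act_rel[OF gl2_rels.Z_mult[of a v b t reps]] by (simp flip: act_append)
qed (auto simp: word_Z_def)

lemma act_R_Z:
  assumes "a \<in> \<U>" "b \<in> \<U>"
  shows "act (word_R a) (act (word_Z b) A) = act (word_Z b) (act (word_R a) A)"
proof (cases "a = 1 \<or> b = 1")
  case False
  then show ?thesis
    using assms act_commutator[OF _ _ gl2_rels.R_Z[of a v b t reps]] by simp
qed (auto simp: word_Z_def)

lemma act_S_Z:
  assumes "a \<in> \<U>"
  shows "act word_S (act (word_Z a) A) = act (word_Z a) (act word_S A)"
proof (cases "a = 1")
  case False
  then show ?thesis
    using assms act_commutator[OF _ _ gl2_rels.S_Z[of a v t reps]] by simp
qed (auto simp: word_Z_def)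

lemma act_S_R:
  assumes \<alpha>: "\<alpha> \<in> value_monoid v - {0}" and a: "a \<in> \<U>"
  shows "act word_S (act (word_R (1 - a * t \<alpha>)) (act word_S (act (word_R (inverse (1 - a * t \<alpha>))) A)))
    = act (word_R a) (act word_S (act (word_R (1 - t \<alpha>)) (act word_S
        (act (word_R (inverse (1 - t \<alpha>))) (act (word_R (inverse a)) A)))))"
proof (cases "a = 1")
  case False
  have "1 - a * t \<alpha> \<in> \<U>" "1 - t \<alpha> \<in> \<U>" using assms t_ideal by auto
  then show ?thesis
    using assms False fun_cong[OF act_rel[OF gl2_rels.S_R[of \<alpha> v a t reps]], of A]
    by (simp add: commutator_word_def act_append inv_word_words)
qed simp

lemma act_S_R_S:
  assumes "a \<in> reps"
  shows "act word_S (act (word_R a) (act word_S A))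
    = act (word_R (1 - a)) (act word_S (act (word_R (a / (a - 1))) A))"
proof -
  have a: "a \<in> \<U>" "1 - a \<in> \<U>" using assms reps_unit by auto
  then have "- (1 - a) \<in> \<U>" by (simp only: unit_minus)
  then have "a / (a - 1) \<in> \<U>" using a by simp
  then show ?thesis
    using a assms fun_cong[OF act_rel[OF gl2_rels.S_R_S[of a reps v t]], of A]
    by (simp add: act_append)
qed

lemma act_J_S:
  "act word_J (act word_S (act word_J (act word_S (act word_J (act word_S A))))) = A"
  using act_rel[OF gl2_rels.J_S[of v t reps]] by (simp flip: act_append)

text \<open>The whole calculus of translations and cells now applies to the left regular action.
  \<open>z\<close> is passed as an explicit composite to match its defining equation in the locale;
  \<open>act_Z\<close> identifies it with the action of \<open>word_Z\<close>.\<close>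

sublocale gl2_action v t reps "\<lambda>a. act (word_R a)" "act word_S" "act word_J"
  "\<lambda>a A. act word_J (act (word_R a) (act word_J (act (word_R a) A)))"
proof unfold_locales
  show "t \<alpha> \<noteq> 0 \<and> v (t \<alpha>) = \<alpha>" if "\<alpha> \<in> value_monoid v" for \<alpha>
    using t_value[OF that] by blast
qed ((rule act_R_R act_S_R act_S_R_S act_J_S reps_unit reps_cover; assumption)
      | (simp only: act_Z unit_mult, rule act_Z_Z act_R_Z act_S_Z; assumption) | simp)+

section \<open>Normal forms as words; kernel and image of the matrix map\<close>

definition word_T :: "'k \<Rightarrow> 'k gl2_gen word" where
  "word_T x = (if x \<in> \<U> then word_R x @ word_S @ word_R (- inverse x)
     else word_S @ word_R (1 - x) @ word_S @ word_R (inverse (1 - x)))"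

lemma word_T_words [simp]:
  assumes "x \<in> \<O>"
  shows "word_T x \<in> words X"
  using assms ring_not_unit[of x] by (auto simp: word_T_def)

lemma act_T:
  assumes "x \<in> \<O>"
  shows "act (word_T x) = T x"
  using assms ring_not_unit[of x] by (auto simp: word_T_def T_def D_def act_append fun_eq_iff)

lemma word_matrix_T [simp]:
  assumes "x \<in> \<O>"
  shows "word_matrix (word_T x) = mat2 1 x 0 1"
proof (cases "x \<in> \<U>")
  case False
  then have "1 - x \<in> \<U>" using assms ring_not_unit[of x] by simp
  from unit_nonzero[OF this] show ?thesis using False by (simp add: word_T_def mat2_mult)
qed (simp add: word_T_def mat2_mult)

text \<open>Letters are appended on the right because the union of the cells is stable under right
  multiplication by each generator.\<close>

lemma act_cells:
  assumes "w \<in> words X"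
  shows "act w \<in> big_cell \<union> small_cell"
  using assms
proof (induction w rule: rev_induct)
  case Nil
  have "act [] = (\<lambda>A. A)" by (simp add: fun_eq_iff)
  \<comment> \<open>The identity is \<open>j T 0 j\<close>.\<close>
  then show ?case using small_cellI[of 0] by simp
next
  case (snoc l w)
  obtain g e where l: "l = (g, e)" by force
  have w: "w \<in> words X" "[l] \<in> words X" and g: "g \<in> X" using snoc.prems by (auto simp: words_def l)
  have IH: "act w \<in> big_cell \<union> small_cell" using snoc.IH w by simp
  have eq: "act (w @ [l]) = (\<lambda>A. act w (act [l] A))" using w by (simp add: act_append fun_eq_iff)
  show ?case
  proof (cases g)
    case (Gen_R a)
    then have a: "a \<in> \<U>" "a \<noteq> 1" using g by (auto simp: gl2_gens_def)
    have "[l] = (if e then word_R a else inv_word (word_R a))"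
      using a by (simp add: l Gen_R word_R_def inv_word_def)
    then have "act [l] A = act (word_R (if e then a else inverse a)) A" for A using a by simp
    then show ?thesis
      unfolding eq using IH a big_cell_r[of "act w" "if e then a else inverse a"]
        small_cell_r[of "act w" "if e then a else inverse a"] by auto
  next
    case Gen_S
    have "[l] = (if e then word_S else inv_word word_S)"
      by (simp add: l Gen_S word_S_def inv_word_def)
    then have "act [l] A = act word_S A" for A by simp
    then show ?thesis unfolding eq using IH big_cell_s small_cell_s by auto
  next
    case Gen_J
    have "[l] = (if e then word_J else inv_word word_J)"
      by (simp add: l Gen_J word_J_def inv_word_def)
    then have "act [l] A = act word_J A" for A by simp
    then show ?thesis unfolding eq using IH big_cell_j small_cell_j by auto
  qed
qed

text \<open>The action of \<open>w\<close> equals that of a normal-form word, which therefore has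
  the same matrix; its parameters can be read off from the entries.\<close>

lemma word_matrix_kernel:
  assumes w: "w \<in> words X" and 1: "word_matrix w = mat2 1 0 0 1"
  shows "(w, []) \<in> word_cong X E"
proof -
  have "act w \<in> big_cell \<union> small_cell" using w by (rule act_cells)
  then show ?thesis
  proof
    assume "act w \<in> big_cell"
    then show ?thesis
    proof cases
      case (1 d b a y)
      define u where "u = word_Z d @ word_T b @ word_R a @ word_J @ word_T y"
      have u: "u \<in> words X" using 1 by (simp add: u_def)
      have "act w = act u" using 1 by (simp add: u_def act_append act_Z act_T fun_eq_iff)
      then have "word_matrix w = word_matrix u" using w u cong_if_act_eq word_cong_matrix by blast
      \<comment> \<open>The lower-left entry of the matrix of \<open>u\<close> is
        \<open>- d\<close>, a unit, so it cannot be 0.\<close>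
      then show ?thesis using 1 assms(2) by (simp add: u_def mat2_mult mat2_eq_iff)
    qed
  next
    assume "act w \<in> small_cell"
    then show ?thesis
    proof cases
      case (1 d b a x)
      define u where "u = word_Z d @ word_T b @ word_R a @ word_J @ word_T x @ word_J"
      have u: "u \<in> words X" using 1 by (simp add: u_def)
      have "act w = act u" using 1 by (simp add: u_def act_append act_Z act_T fun_eq_iff)
      then have "word_matrix w = word_matrix u" using w u cong_if_act_eq word_cong_matrix by blast
      then have "d = 1" "b = 0" "a = 1" "x = 0"
        using 1 assms(2) by (auto simp: u_def mat2_mult mat2_eq_iff)
      then have "act w = act []" using 1 by (simp add: fun_eq_iff)
      then show ?thesis using w cong_if_act_eq by simp
    qed
  qed
qed

lemma word_matrix_inj:
  assumes "u \<in> words X" "w \<in> words X" "word_matrix u = word_matrix w"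
  shows "(u, w) \<in> word_cong X E"
proof -
  have iu: "inv_word u \<in> words X" using assms inv_word_words by blast
  have "word_matrix (inv_word u @ w) = word_matrix (inv_word u @ u)" using assms by simp
  also have "\<dots> = mat2 1 0 0 1" using word_cong_matrix[OF inv_word_cong[OF assms(1)]] by simp
  finally have "act (inv_word u @ w) = act []"
    using assms iu by (intro act_cong word_matrix_kernel) auto
  then have "act (inv_word u) (act w A) = A" for A
    using assms iu act_append[of "inv_word u" w A] by simp
  then have "act u A = act w A" for A
    using assms act_inv_right[of u "act w A"] by metis
  then show ?thesis using assms by (intro cong_if_act_eq) auto
qed

lemma word_matrix_surj:
  assumes M: "M \<in> carrier (GL2 \<O>)"
  shows "\<exists>w\<in>words X. word_matrix w = M"
proof -
  obtain a b c d where M': "M = mat2 a b c d" using mat2_surj by blast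
  have entries: "a \<in> \<O>" "b \<in> \<O>" "c \<in> \<O>" "d \<in> \<O>"
    using M by (simp_all add: M' GL2_def mat2_over_iff)
  define \<delta> where "\<delta> = a * d - b * c"
  have \<delta>: "\<delta> \<in> \<U>" using GL2_det M by (simp add: M' \<delta>_def)
  have div: "x / y \<in> \<O>" if "x \<in> \<O>" "y \<in> \<U>" for x y using that by (simp add: divide_inverse)
  show ?thesis
  proof (cases "c \<in> \<U>")
    case True
    \<comment> \<open>In the big cell the bottom row fixes the central factor and the right
      translation, and the upper-left entry fixes the left one. The argument of
      \<open>word_R\<close> comes from the determinant, where \<open>word_J\<close> contributes
      -1.\<close>
    define w where "w = word_Z (- c) @ word_T (a / c) @ word_R (- \<delta> / (c * c)) @ word_J @ word_T (d / c)"
    have "w \<in> words X" using True \<delta> entries div by (simp add: w_def)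
    moreover have "word_matrix w = M"
      using True entries div by (simp add: w_def M' mat2_mult mat2_eq_iff \<delta>_def field_simps)
    ultimately show ?thesis by blast
  next
    case False
    then have c: "c \<in> \<MM>" using entries ring_not_unit by blast
    have d: "d \<in> \<U>"
    proof (rule ccontr)
      assume "d \<notin> \<U>"
      then have "d \<in> \<MM>" using entries ring_not_unit by blast
      then have "\<delta> \<in> \<MM>" using entries c by (simp add: \<delta>_def ring_mult_ideal)
      then show False using \<delta> ideal_not_unit by blast
    qed
    \<comment> \<open>Here the lower-right entry fixes the central factor and the off-diagonal
      entries fix the translations; the two \<open>word_J\<close> contribute 1 to the
      determinant.\<close>
    define w where "w = word_Z d @ word_T (b / d) @ word_R (\<delta> / (d * d)) @ word_J @ word_T (c / d) @ word_J"
    have "w \<in> words X" using d \<delta> entries div by (simp add: w_def)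
    moreover have "word_matrix w = M"
      using d entries div by (simp add: w_def M' mat2_mult mat2_eq_iff \<delta>_def field_simps)
    ultimately show ?thesis by blast
  qed
qed

section \<open>The isomorphism onto the matrix group\<close>

definition class_matrix :: "'k gl2_gen word set \<Rightarrow> 'k^2^2" where
  "class_matrix A = word_matrix (SOME w. w \<in> A)"

text \<open>The choice of a representative is harmless, as congruent words have equal
  matrices.\<close>

lemma class_matrix_cls:
  assumes "w \<in> words X"
  shows "class_matrix (cls w) = word_matrix w"
proof -
  have "w \<in> cls w" using assms by (simp add: word_class_def word_cong.refl)
  then have "(SOME u. u \<in> cls w) \<in> cls w" by (rule someI)
  then show ?thesis unfolding class_matrix_def by (simp add: word_class_def word_cong_matrix)
qed

lemma class_matrix_iso: "class_matrix \<in> iso P (GL2 \<O>)"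
proof (rule isoI)
  show "class_matrix \<in> hom P (GL2 \<O>)"
    by (rule homI) (auto simp: carrier_presented_group class_matrix_cls presented_group_mult
        word_matrix_GL2, simp add: GL2_def)
  have "inj_on class_matrix (carrier P)"
    unfolding carrier_presented_group inj_on_def ball_simps
    by (simp add: class_matrix_cls word_class_eq_iff word_matrix_inj)
  moreover have "class_matrix ` carrier P = carrier (GL2 \<O>)"
    using word_matrix_surj
    by (fastforce simp: carrier_presented_group class_matrix_cls word_matrix_GL2 image_image)
  ultimately show "bij_betw class_matrix (carrier P) (carrier (GL2 \<O>))"
    by (simp add: bij_betw_def)
qed

end

theorem theorem3p8:
  fixes v :: "'k::field \<Rightarrow> 'l::linordered_ab_group_add"
    and t :: "'l \<Rightarrow> 'k"
    and reps :: "'k set"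
  assumes "valuation v"
    and "\<And>\<alpha>. \<alpha> \<in> value_monoid v \<Longrightarrow> t \<alpha> \<in> val_ring v - {0} \<and> v (t \<alpha>) = \<alpha>"
    and "t 0 = 1"
    and "reps \<subseteq> val_units v - {1 + m | m. m \<in> val_ideal v}"
    and "bij_betw (residue_class v) reps
           (residue_field v - {residue_class v 0, residue_class v 1})"
  shows "\<exists>\<phi> \<in> iso (presented_group (gl2_gens v) (gl2_rels v t reps)) (GL2 (val_ring v)).
           \<forall>g \<in> gl2_gens v.
             \<phi> (word_class (gl2_gens v) (gl2_rels v t reps) [(g, True)]) = gl2_matrix g"
proof -
  interpret gl2_presentation v t reps
    using assms by unfold_locales
  have "class_matrix (cls [(g, True)]) = gl2_matrix g" if "g \<in> X" for g
    using that by (simp add: class_matrix_cls words_def letter_matrix_gen flip: mat_1_eq_mat2)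
  then show ?thesis using class_matrix_iso by blast
qed

end
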